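(* Let $S\subseteq\mathbb{R}^d$. If $(S,\Phi)$ is a tiling pair with $\Phi\subseteq\mathbb{Z}^d$, then the volume of $S$ is a natural number. Consequently, if $A\in\mathbb{R}^{d\times d}$ is nonsingular and $(\mathcal{Q},\Phi)$ is a tiling pair with $\Phi\subseteq A\mathbb{Z}^d$, where $\mathcal{Q}=[0,1)^d$, then $|\det A|=1/N$ for some $N\in\mathbb{N}$.
   Context: For a measurable set $S\subseteq\mathbb{R}^d$ and a discrete set $\Phi\subseteq\mathbb{R}^d$, $(S,\Phi)$ is called a tiling pair if the sets $S+\varphi$, $\varphi\in\Phi$, form a partition of $\mathbb{R}^d$, i.e. $\bigcup_{\varphi\in\Phi}(S+\varphi)=\mathbb{R}^d$ and $(S+\varphi)\cap(S+\varphi')=\emptyset$ for all $\varphi\neq\varphi'$ in $\Phi$. The volume of $S$ is its Lebesgue measure, and $\mathbb{N}=\{1,2,3,\ldots\}$.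
   Formalization: The first claim is proved for S of finite volume; without this it fails, since (R^d, {0}) is a tiling pair with {0} contained in Z^d and R^d has infinite volume. *)

theory Defs
  imports "HOL-Analysis.Analysis"
begin

definition tiling_pair :: "(real ^ 'n) set \<Rightarrow> (real ^ 'n) set \<Rightarrow> bool" where
  "tiling_pair S \<Phi> \<longleftrightarrow>
     S \<in> sets lebesgue \<and> discrete \<Phi> \<and>
     (\<Union>\<phi>\<in>\<Phi>. (\<lambda>x. x + \<phi>) ` S) = UNIV \<and>
     disjoint_family_on (\<lambda>\<phi>. (\<lambda>x. x + \<phi>) ` S) \<Phi>"

definition integer_lattice :: "(real ^ 'n) set" where
  "integer_lattice = {x. \<forall>i. x $ i \<in> \<int>}"

definition half_open_unit_cube :: "(real ^ 'n) set" where
  "half_open_unit_cube = {x. \<forall>i. 0 \<le> x $ i \<and> x $ i < 1}"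

end

theory Submission
  imports Defs
begin

text \<open>
  For a point \<open>x\<close> let \<open>T x\<close> be the set of integer vectors \<open>z\<close> with \<open>x + z \<in> S\<close>. Cutting \<open>S\<close> along the
  integer translates of the unit cube and moving all the pieces back into that cube shows that the
  volume of \<open>S\<close> is the integral of \<open>card (T x)\<close> over the cube (\<open>emeasure_eq_integral_fibres\<close>).

  Since \<open>\<Phi>\<close> consists of integer vectors, every \<open>T x\<close> tiles the integer lattice with the same set of
  translations \<open>\<Phi>\<close>. Two sets \<open>T\<close> and \<open>T'\<close> that tile an abelian group with the same \<open>\<Phi>\<close> have the same
  cardinality: consider the triples \<open>(t, t', \<phi>)\<close> with \<open>t + t' + \<phi> = 0\<close>. Because \<open>T'\<close> tiles, each
  \<open>t\<close> belongs to exactly one triple; because \<open>T\<close> tiles, so does each \<open>t'\<close>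
  (\<open>tile_fibres_equinumerous\<close>). The integrand is therefore a constant, nonzero since a tile meets
  every coset of the lattice, and the cube has volume one. So the volume is a positive integer
  unless it is infinite.

  The consequence about the cube follows on applying the linear map inverse to \<open>A\<close>: it turns the cube
  into a set of volume \<open>1 / \<bar>det A\<bar>\<close> that tiles with integer translations. The volume of the image is
  given by \<open>linear_scales_volume_by_det\<close>, proved by factoring the map into elementary ones.
\<close>

section \<open>Tiles meet all cosets equally often\<close>

lemma tiling_pair_unique_translate:
  fixes S \<Phi> :: "(real ^ 'n) set"
  assumes "tiling_pair S \<Phi>"
  shows "\<exists>!\<phi>. \<phi> \<in> \<Phi> \<and> x - \<phi> \<in> S"
proof -
  have cover: "(\<Union>\<phi>\<in>\<Phi>. (\<lambda>x. x + \<phi>) ` S) = UNIV"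
    and disj: "disjoint_family_on (\<lambda>\<phi>. (\<lambda>x. x + \<phi>) ` S) \<Phi>"
    using assms by (auto simp: tiling_pair_def)
  have translate: "y - \<phi> \<in> S \<longleftrightarrow> y \<in> (\<lambda>x. x + \<phi>) ` S" for y \<phi> :: "real ^ 'n"
    by (force simp: image_iff)
  show ?thesis
    using cover disj unfolding translate disjoint_family_on_def by blast
qed

text \<open>
  Consider the triples \<open>(z, w, \<phi>)\<close> with \<open>z + w + \<phi> = 0\<close>, \<open>x + z \<in> S\<close>, \<open>y + w \<in> S\<close> and \<open>\<phi> \<in> \<Phi>\<close>.
  Given \<open>z\<close>, the translation \<open>\<phi>\<close> has to be the one for which \<open>y - z\<close> lies in \<open>S + \<phi>\<close>, and then
  \<open>w = - z - \<phi>\<close>; so \<open>z\<close> belongs to exactly one triple. The conditions are symmetric in \<open>(x, z)\<close> and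
  \<open>(y, w)\<close>, so \<open>z \<mapsto> w\<close> is a bijection between the two fibres.
\<close>

lemma tile_fibres_equinumerous:
  fixes S \<Phi> L :: "'a :: ab_group_add set"
  assumes tile: "\<And>x. \<exists>!\<phi>. \<phi> \<in> \<Phi> \<and> x - \<phi> \<in> S"
    and "\<Phi> \<subseteq> L"
    and closed: "\<And>a b. a \<in> L \<Longrightarrow> b \<in> L \<Longrightarrow> - a - b \<in> L"
  shows "\<exists>f. bij_betw f {z \<in> L. x + z \<in> S} {w \<in> L. y + w \<in> S}"
proof -
  define p where "p u = (THE \<phi>. \<phi> \<in> \<Phi> \<and> u - \<phi> \<in> S)" for u
  have p: "p u \<in> \<Phi>" "u - p u \<in> S" for u
    using theI'[OF tile[of u]] by (auto simp: p_def)
  have p_eq: "p u = \<phi>" if "\<phi> \<in> \<Phi>" "u - \<phi> \<in> S" for u \<phi>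
    using tile[of u] p[of u] that by blast
  define partner where "partner u z = - z - p (u - z)" for u z
  have maps: "partner u z \<in> {w \<in> L. u + w \<in> S}" if "z \<in> L" for u z
    using p[of "u - z"] closed[of z "p (u - z)"] that \<open>\<Phi> \<subseteq> L\<close>
    by (auto simp: partner_def algebra_simps)
  have inverse: "partner u (partner v z) = z" if "u + z \<in> S" for u v z
  proof -
    have eq: "u - partner v z - p (v - z) = u + z"
      by (simp add: partner_def algebra_simps)
    have "p (u - partner v z) = p (v - z)"
      using that p(1) by (intro p_eq) (simp_all only: eq)
    then show ?thesis
      by (simp add: partner_def[of u]) (simp add: partner_def)
  qed
  have "bij_betw (partner y) {z \<in> L. x + z \<in> S} {w \<in> L. y + w \<in> S}"
    by (rule bij_betw_byWitness[where f' = "partner x"]) (use maps inverse in auto)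
  then show ?thesis
    by blast
qed

section \<open>The integer lattice and the unit cube\<close>

lemma countable_integer_lattice: "countable (integer_lattice :: (real ^ 'n) set)"
  unfolding integer_lattice_def by (rule countable_vector) (simp add: Ints_def)

lemma half_open_unit_cube_unique_translate:
  fixes x :: "real ^ 'n"
  shows "\<exists>!z. z \<in> integer_lattice \<and> x - z \<in> half_open_unit_cube"
proof
  show "(\<chi> i. of_int \<lfloor>x $ i\<rfloor>) \<in> integer_lattice \<and> x - (\<chi> i. of_int \<lfloor>x $ i\<rfloor>) \<in> half_open_unit_cube"
    by (auto simp: integer_lattice_def half_open_unit_cube_def) linarith
next
  fix z assume z: "z \<in> integer_lattice \<and> x - z \<in> half_open_unit_cube"
  have "z $ i = of_int \<lfloor>x $ i\<rfloor>" for i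
  proof -
    obtain k where "z $ i = of_int k"
      using z by (auto simp: integer_lattice_def elim: Ints_cases)
    moreover have "0 \<le> x $ i - z $ i" "x $ i - z $ i < 1"
      using z by (auto simp: half_open_unit_cube_def)
    ultimately show ?thesis
      by (simp add: floor_unique)
  qed
  then show "z = (\<chi> i. of_int \<lfloor>x $ i\<rfloor>)"
    by (simp add: vec_eq_iff)
qed

lemma half_open_unit_cube_borel:
  "(half_open_unit_cube :: (real ^ 'n) set) \<in> sets borel"
proof -
  have "(half_open_unit_cube :: (real ^ 'n) set) = (\<Inter>i. {x. 0 \<le> x $ i} \<inter> {x. x $ i < 1})"
    by (auto simp: half_open_unit_cube_def)
  also have "\<dots> \<in> sets borel"
    by (intro sets.finite_INT sets.Int borel_open borel_closed
        open_halfspace_component_lt_cart closed_halfspace_component_ge_cart) auto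
  finally show ?thesis .
qed

lemma half_open_unit_cube_lebesgue:
  "(half_open_unit_cube :: (real ^ 'n) set) \<in> sets lebesgue"
  by (intro sets_completionI_sets) (simp add: half_open_unit_cube_borel)

lemma emeasure_half_open_unit_cube:
  "emeasure lebesgue (half_open_unit_cube :: (real ^ 'n) set) = 1"
proof (rule antisym)
  have mono: "emeasure lborel A \<le> emeasure lborel B"
    if "A \<subseteq> B" "B \<in> sets borel" for A B :: "(real ^ 'n) set"
    using that by (simp add: emeasure_mono)
  have one_inner: "(1 :: real ^ 'n) \<bullet> b = 1" if "b \<in> Basis" for b
    using that by (auto simp: Basis_vec_def inner_axis)
  have closed_cube: "emeasure lborel (cbox 0 1 :: (real ^ 'n) set) = 1"
    by (subst emeasure_lborel_cbox) (auto simp: one_inner)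
  have open_cube: "emeasure lborel (box 0 1 :: (real ^ 'n) set) = 1"
    by (subst emeasure_lborel_box) (auto simp: one_inner)
  have lborel: "emeasure lebesgue (half_open_unit_cube :: (real ^ 'n) set)
      = emeasure lborel (half_open_unit_cube :: (real ^ 'n) set)"
    by (simp add: half_open_unit_cube_lebesgue half_open_unit_cube_borel)
  show "emeasure lebesgue (half_open_unit_cube :: (real ^ 'n) set) \<le> 1"
    unfolding lborel closed_cube[symmetric]
    by (rule mono) (auto simp: half_open_unit_cube_def mem_box_cart less_imp_le)
  show "1 \<le> emeasure lebesgue (half_open_unit_cube :: (real ^ 'n) set)"
    unfolding lborel open_cube[symmetric]
    by (rule mono) (auto simp: half_open_unit_cube_def mem_box_cart less_imp_le half_open_unit_cube_borel)
qed

section \<open>The volume as an average of fibre cardinalities\<close>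

lemma lebesgue_translate:
  fixes S :: "'a :: euclidean_space set"
  assumes "S \<in> sets lebesgue"
  shows "{x. x + z \<in> S} \<in> sets lebesgue"
proof -
  have "{x. x + z \<in> S} = (+) (- z) ` S"
    by (force simp: image_iff)
  then show ?thesis
    using lebesgue_sets_translation[OF assms, of "- z"] by (simp only:)
qed

text \<open>
  The translate \<open>half_open_unit_cube + z\<close> cuts a piece out of \<open>S\<close>; moved back by \<open>z\<close> it consists of
  the points \<open>x\<close> of the cube with \<open>x + z \<in> S\<close>. Adding up over \<open>z\<close> first counts how many pieces
  cover \<open>x\<close>.
\<close>

lemma emeasure_eq_integral_fibres:
  fixes S :: "(real ^ 'n) set"
  assumes S: "S \<in> sets lebesgue"
  shows "emeasure lebesgue S =
    (\<integral>\<^sup>+x\<in>half_open_unit_cube.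
        emeasure (count_space integer_lattice) {z \<in> integer_lattice. x + z \<in> S} \<partial>lebesgue)"
proof -
  let ?L = "integer_lattice :: (real ^ 'n) set" and ?Q = "half_open_unit_cube :: (real ^ 'n) set"
  define piece where "piece z = ?Q \<inter> {x. x + z \<in> S}" for z
  have piece: "piece z \<in> sets lebesgue" for z
    unfolding piece_def by (intro sets.Int half_open_unit_cube_lebesgue lebesgue_translate S)
  have piece_translate: "(\<lambda>x. x + z) ` piece z \<in> sets lebesgue" for z
    using lebesgue_sets_translation[OF piece, of z z] by (simp only: add.commute)
  have moved: "y \<in> (\<lambda>x. x + z) ` piece z \<longleftrightarrow> y \<in> S \<and> y - z \<in> ?Q" for y z
    by (force simp: piece_def image_iff)
  have S_eq: "S = (\<Union>z\<in>?L. (\<lambda>x. x + z) ` piece z)"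
    using half_open_unit_cube_unique_translate unfolding set_eq_iff UN_iff moved by blast
  have disj: "disjoint_family_on (\<lambda>z. (\<lambda>x. x + z) ` piece z) ?L"
    using half_open_unit_cube_unique_translate
    unfolding disjoint_family_on_def set_eq_iff Int_iff moved by blast
  have "emeasure lebesgue S = (\<integral>\<^sup>+z. emeasure lebesgue ((\<lambda>x. x + z) ` piece z) \<partial>count_space ?L)"
    by (subst S_eq) (intro emeasure_UN_countable piece_translate disj countable_integer_lattice)
  also have "\<dots> = (\<integral>\<^sup>+z. emeasure lebesgue (piece z) \<partial>count_space ?L)"
    using emeasure_lebesgue_affine[of 1 z "piece z" for z] by (simp add: add.commute)
  also have "\<dots> = (\<integral>\<^sup>+z. \<integral>\<^sup>+x. indicator (piece z) x \<partial>lebesgue \<partial>count_space ?L)"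
    using piece by simp
  also have "\<dots> = (\<integral>\<^sup>+x. \<integral>\<^sup>+z. indicator (piece z) x \<partial>count_space ?L \<partial>lebesgue)"
    using piece countable_integer_lattice
    by (intro nn_integral_count_space_nn_integral[symmetric]) auto
  also have "\<dots> = (\<integral>\<^sup>+x\<in>?Q. emeasure (count_space ?L) {z \<in> ?L. x + z \<in> S} \<partial>lebesgue)"
  proof (rule nn_integral_cong)
    fix x
    have "(\<integral>\<^sup>+z. indicator (piece z) x \<partial>count_space ?L)
        = (\<integral>\<^sup>+z. indicator {z \<in> ?L. x + z \<in> S} z * indicator ?Q x \<partial>count_space ?L)"
      by (rule nn_integral_cong) (auto simp: piece_def indicator_def)
    then show "(\<integral>\<^sup>+z. indicator (piece z) x \<partial>count_space ?L)
        = emeasure (count_space ?L) {z \<in> ?L. x + z \<in> S} * indicator ?Q x"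
      by (simp add: nn_integral_multc)
  qed
  finally show ?thesis .
qed

section \<open>Linear maps scale volume by their determinant\<close>

text \<open>
  Linearity is part of the predicate so that it is closed under composition: the rule that the
  matrix of a composition is the product of the matrices needs linear maps.
\<close>

definition scales_volume_by_det :: "(real ^ 'n \<Rightarrow> real ^ 'n) \<Rightarrow> bool" where
  "scales_volume_by_det f \<longleftrightarrow> linear f \<and>
     (\<forall>S \<in> lmeasurable. f ` S \<in> lmeasurable \<and>
        measure lebesgue (f ` S) = \<bar>det (matrix f)\<bar> * measure lebesgue S)"

lemma scales_volume_by_det_compose:
  assumes "scales_volume_by_det f" "scales_volume_by_det g"
  shows "scales_volume_by_det (f \<circ> g)"
  using assms unfolding scales_volume_by_det_def
  by (auto simp: linear_compose image_comp[symmetric] matrix_compose det_mul abs_mult simp del: o_apply)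

lemma scales_volume_by_det_singular:
  assumes "linear f" "\<not> inj f"
  shows "scales_volume_by_det f"
proof -
  have "negligible (f ` S)" for S
    using assms by (rule negligible_linear_singular_image)
  moreover have "det (matrix f) = 0"
    using assms det_nz_iff_inj by blast
  ultimately show ?thesis
    using \<open>linear f\<close> by (simp add: scales_volume_by_det_def negligible_iff_measure)
qed

lemma scales_volume_by_det_diagonal:
  "scales_volume_by_det (\<lambda>x. \<chi> i. c i * x $ i)"
proof -
  have "linear (\<lambda>x. \<chi> i. c i * x $ i)"
    by (rule linearI) (auto simp: vec_eq_iff algebra_simps)
  moreover have "det (matrix (\<lambda>x. \<chi> i. c i * x $ i)) = prod c UNIV"
    by (subst det_diagonal) (auto simp: matrix_def axis_def)
  ultimately show ?thesis
    by (simp add: scales_volume_by_det_def measurable_stretch measure_stretch)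
qed

lemma scales_volume_by_det_shear:
  assumes "m \<noteq> n"
  shows "scales_volume_by_det (\<lambda>x. \<chi> i. if i = m then x $ m + x $ n else x $ i)"
    (is "scales_volume_by_det ?h")
proof -
  have lin: "linear ?h"
    by (rule linearI) (auto simp: vec_eq_iff algebra_simps)
  have "matrix ?h = (\<chi> k. if k = m then row m (mat 1) + 1 *s row n (mat 1) else row k (mat 1))"
    by (auto simp: vec_eq_iff matrix_def row_def mat_def axis_def)
  then have det: "det (matrix ?h) = 1"
    using det_row_operation[OF assms, where A = "mat 1" and c = 1] by simp
  have box: "measure lebesgue (?h ` cbox a b) = measure lebesgue (cbox a b)" for a b
  proof (cases "cbox a b = {}")
    case False
    \<comment> \<open>Sheared boxes are measured where the \<open>n\<close>-th coordinate is nonnegative; translate there.\<close>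
    define v where "v = axis n (a $ n)"
    have moved: "cbox a b = (+) v ` cbox (a - v) (b - v)"
      using cbox_translation[of v "a - v" "b - v"] by simp
    have "?h ` cbox a b = (+) (?h v) ` ?h ` cbox (a - v) (b - v)"
      unfolding moved image_image by (simp only: linear_add[OF lin])
    then have "measure lebesgue (?h ` cbox a b) = measure lebesgue (?h ` cbox (a - v) (b - v))"
      by (simp only: measure_translation)
    also have "\<dots> = measure lebesgue (cbox (a - v) (b - v))"
      using assms False by (intro measure_shear_interval) (auto simp: moved v_def)
    also have "\<dots> = measure lebesgue (cbox a b)"
      unfolding moved by (rule measure_translation[symmetric])
    finally show ?thesis .
  qed simp
  have scaling: "?h ` S \<in> lmeasurable \<and> 1 * measure lebesgue S = measure lebesgue (?h ` S)"
    if "S \<in> lmeasurable" for S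
    by (rule measure_linear_sufficient[OF lin that]) (unfold mult_1, rule box)
  show ?thesis
    unfolding scales_volume_by_det_def det abs_one
    by (intro conjI ballI lin scaling[THEN conjunct1] scaling[THEN conjunct2, symmetric])
qed

text \<open>
  Shears and a sign change generate the swap of two coordinates, so neither its determinant nor its
  effect on boxes has to be computed. On the \<open>m\<close>-th and \<open>n\<close>-th coordinates the factorization is
  \<open>(x, y) \<mapsto> (x + y, y) \<mapsto> (x + y, - y) \<mapsto> (x + y, x) \<mapsto> (x + y, - x) \<mapsto> (y, - x) \<mapsto> (y, x)\<close>.
\<close>

lemma scales_volume_by_det_swap:
  fixes m n :: "'n :: finite"
  assumes "m \<noteq> n"
  shows "scales_volume_by_det (\<lambda>x :: real ^ 'n. \<chi> i. x $ Transposition.transpose m n i)"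
proof -
  define D where "D = (\<lambda>x :: real ^ 'n. \<chi> i. (if i = n then - 1 else 1) * x $ i)"
  define E where "E k l = (\<lambda>x :: real ^ 'n. \<chi> i. if i = k then x $ k + x $ l else x $ i)" for k l
  have "scales_volume_by_det (D \<circ> E m n \<circ> D \<circ> E n m \<circ> D \<circ> E m n)"
    unfolding D_def E_def using assms
    by (intro scales_volume_by_det_compose scales_volume_by_det_diagonal scales_volume_by_det_shear) auto
  also have "D \<circ> E m n \<circ> D \<circ> E n m \<circ> D \<circ> E m n = (\<lambda>x. \<chi> i. x $ Transposition.transpose m n i)"
    using assms by (auto simp: fun_eq_iff vec_eq_iff D_def E_def Transposition.transpose_def)
  finally show ?thesis .
qed

text \<open>
  Gaussian elimination factors a linear map into the types of maps treated above.
\<close>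

proposition linear_scales_volume_by_det:
  assumes "linear f"
  shows "scales_volume_by_det f"
  using assms
proof (rule induct_linear_elementary)
  fix f :: "real ^ 'n \<Rightarrow> real ^ 'n" and i
  assume "linear f" and zero: "\<And>x. f x $ i = 0"
  then have "\<not> inj f"
    by (metis linear_injective_imp_surjective one_neq_zero surjE vec_component)
  with \<open>linear f\<close> show "scales_volume_by_det f"
    by (rule scales_volume_by_det_singular)
qed (rule scales_volume_by_det_compose scales_volume_by_det_diagonal scales_volume_by_det_swap
    scales_volume_by_det_shear; assumption)+

section \<open>Volumes of tiles\<close>

theorem integer_tile_volume:
  fixes S :: "(real ^ 'n) set"
  assumes S: "S \<in> sets lebesgue"
    and tile: "\<And>x. \<exists>!\<phi>. \<phi> \<in> \<Phi> \<and> x - \<phi> \<in> S"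
    and \<Phi>: "\<Phi> \<subseteq> integer_lattice"
    and finite_volume: "emeasure lebesgue S < \<infinity>"
  shows "\<exists>N::nat. N \<ge> 1 \<and> emeasure lebesgue S = of_nat N"
proof -
  let ?L = "integer_lattice :: (real ^ 'n) set" and ?Q = "half_open_unit_cube :: (real ^ 'n) set"
  define T where "T x = {z \<in> ?L. x + z \<in> S}" for x
  have "- a - b \<in> ?L" if "a \<in> ?L" "b \<in> ?L" for a b
    using that by (auto simp: integer_lattice_def)
  then have "\<exists>f. bij_betw f (T x) (T 0)" for x
    unfolding T_def by (intro tile_fibres_equinumerous[OF tile \<Phi>])
  then have fibres: "emeasure (count_space ?L) (T x) = emeasure (count_space ?L) (T 0)" for x
    by (metis (no_types, lifting) T_def bij_betw_finite bij_betw_same_card emeasure_count_space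
        mem_Collect_eq subsetI)
  have "emeasure lebesgue S = (\<integral>\<^sup>+x\<in>?Q. emeasure (count_space ?L) (T x) \<partial>lebesgue)"
    unfolding T_def by (rule emeasure_eq_integral_fibres[OF S])
  also have "\<dots> = (\<integral>\<^sup>+x\<in>?Q. emeasure (count_space ?L) (T 0) \<partial>lebesgue)"
    using fibres by (intro nn_integral_cong) metis
  also have "\<dots> = emeasure (count_space ?L) (T 0) * emeasure lebesgue ?Q"
    by (rule nn_integral_cmult_indicator[OF half_open_unit_cube_lebesgue])
  finally have volume: "emeasure lebesgue S = emeasure (count_space ?L) (T 0)"
    by (simp only: emeasure_half_open_unit_cube mult_1_right)
  have "T 0 \<subseteq> ?L"
    by (auto simp: T_def)
  with volume finite_volume have "finite (T 0)"
    by (cases "finite (T 0)") auto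
  moreover have "T 0 \<noteq> {}"
  proof -
    obtain \<phi> where "\<phi> \<in> \<Phi>" "0 - \<phi> \<in> S"
      using tile by blast
    then have "- \<phi> \<in> T 0"
      using \<Phi> by (auto simp: T_def integer_lattice_def)
    then show ?thesis by blast
  qed
  ultimately have "card (T 0) \<ge> 1"
    by (simp add: Suc_le_eq card_gt_0_iff)
  moreover have "emeasure lebesgue S = of_nat (card (T 0))"
    using volume \<open>finite (T 0)\<close> \<open>T 0 \<subseteq> ?L\<close> by simp
  ultimately show ?thesis by blast
qed

text \<open>
  With \<open>B\<close> inverse to \<open>A\<close>, the image of the cube under \<open>B\<close> tiles with translations in the image of
  \<open>\<Phi>\<close>, which are integer vectors. Its volume \<open>\<bar>det B\<bar>\<close> is therefore a positive integer \<open>N\<close>.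
\<close>

lemma unit_cube_tiling_determinant:
  fixes A :: "real ^ 'n ^ 'n"
  assumes "invertible A"
    and tiling: "tiling_pair half_open_unit_cube \<Phi>"
    and \<Phi>: "\<Phi> \<subseteq> (\<lambda>z. A *v z) ` integer_lattice"
  shows "\<exists>N::nat. N \<ge> 1 \<and> \<bar>det A\<bar> = 1 / real N"
proof -
  obtain B where AB: "A ** B = mat 1" and BA: "B ** A = mat 1"
    using \<open>invertible A\<close> unfolding invertible_def by blast
  let ?Q = "half_open_unit_cube :: (real ^ 'n) set"
  have A_B[simp]: "A *v (B *v x) = x" and B_A[simp]: "B *v (A *v x) = x" for x
    by (simp_all add: matrix_vector_mul_assoc AB BA)
  have B_image: "u \<in> (*v) B ` M \<longleftrightarrow> A *v u \<in> M" for u and M :: "(real ^ 'n) set"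
    by (force simp: image_iff)
  have Q: "?Q \<in> lmeasurable"
    by (simp add: fmeasurable_def half_open_unit_cube_lebesgue emeasure_half_open_unit_cube
        del: emeasure_completion)
  have BQ: "(*v) B ` ?Q \<in> lmeasurable"
    and "measure lebesgue ((*v) B ` ?Q) = \<bar>det B\<bar> * measure lebesgue ?Q"
    using linear_scales_volume_by_det[OF matrix_vector_mul_linear[of B]] Q
    by (simp_all add: scales_volume_by_det_def)
  then have "measure lebesgue ((*v) B ` ?Q) = \<bar>det B\<bar>"
    by (simp add: measure_def emeasure_half_open_unit_cube del: emeasure_completion)
  then have volume: "emeasure lebesgue ((*v) B ` ?Q) = ennreal \<bar>det B\<bar>"
    using BQ by (simp add: emeasure_eq_measure2)
  have "\<exists>N::nat. N \<ge> 1 \<and> emeasure lebesgue ((*v) B ` ?Q) = of_nat N"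
  proof (rule integer_tile_volume)
    show "(*v) B ` \<Phi> \<subseteq> integer_lattice"
      using \<Phi> by auto
    show "\<exists>!\<psi>. \<psi> \<in> (*v) B ` \<Phi> \<and> x - \<psi> \<in> (*v) B ` ?Q" for x
      using tiling_pair_unique_translate[OF tiling, of "A *v x"]
      unfolding B_image matrix_vector_mult_diff_distrib by (metis A_B B_A)
  qed (use BQ in \<open>auto simp: fmeasurable_def\<close>)
  then obtain N :: nat where N: "N \<ge> 1" "ennreal \<bar>det B\<bar> = of_nat N"
    using volume by auto
  then have "\<bar>det B\<bar> = real N"
    by (simp flip: ennreal_of_nat_eq_real_of_nat) (metis abs_ge_zero ennreal_inj ennreal_of_nat_eq_real_of_nat of_nat_0_le_iff)
  moreover have "\<bar>det A\<bar> * \<bar>det B\<bar> = 1"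
    by (metis AB abs_mult abs_one det_I det_mul)
  ultimately show ?thesis
    using N(1) by (intro exI[of _ N]) (simp add: field_simps)
qed

theorem theorem6:
  shows "(\<forall>(S :: (real ^ 'n) set) \<Phi>.
            tiling_pair S \<Phi> \<and> \<Phi> \<subseteq> integer_lattice \<and> emeasure lebesgue S < \<infinity> \<longrightarrow>
              (\<exists>N::nat. N \<ge> 1 \<and> emeasure lebesgue S = of_nat N)) \<and>
         (\<forall>(A :: real ^ 'n ^ 'n) \<Phi>.
            invertible A \<and> tiling_pair half_open_unit_cube \<Phi> \<and>
            \<Phi> \<subseteq> (\<lambda>z. A *v z) ` integer_lattice \<longrightarrow>
              (\<exists>N::nat. N \<ge> 1 \<and> \<bar>det A\<bar> = 1 / real N))"
proof (intro conjI allI impI; elim conjE)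
  fix S \<Phi> :: "(real ^ 'n) set"
  assume "tiling_pair S \<Phi>" "\<Phi> \<subseteq> integer_lattice" "emeasure lebesgue S < \<infinity>"
  then show "\<exists>N::nat. N \<ge> 1 \<and> emeasure lebesgue S = of_nat N"
    using tiling_pair_unique_translate[of S \<Phi>]
    by (intro integer_tile_volume) (auto simp: tiling_pair_def)
qed (rule unit_cube_tiling_determinant)

end
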